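(* Let $n\geq 3$ be even, $0\le p<\tfrac n2$, $\beta=n-2p$, and let $(M,h)$ be an oriented $n$-dimensional Einstein manifold with $Ric(h)=\tfrac{2J}{n}(n-1)h$, $J\in\mathbb{R}$ constant. Then the critical Branson–Gover operator $L^{(p)}_{n-2p}:\Omega^p(M)\to\Omega^p(M)$ is given by $$L^{(p)}_{n-2p}=(n-2p)\,\delta^hd\circ\prod_{l=1}^{\frac{n-2p}{2}-1}\big[\delta^hd+(\tfrac\beta2-l)(\tfrac\beta2+l-1)\tfrac{2J}{n}\big].$$
   Context: $\delta^h$ is the codifferential of $(M,h)$ (formal adjoint of $d$). $(a)_0=1$, $(a)_k=a(a+1)\cdots(a+k-1)$. For $k\ge0$: $R_k(y;\alpha)=\prod_{l=1}^k[y-(\alpha-l)(\alpha-l+1)]$, $R_0=1$; $R^{(1)}_k(y)=\sum_{j=1}^k(\tfrac\beta2-k+j+1)_{2(k-j)}[y-\tfrac\beta2(\tfrac\beta2+1)]R_{j-1}(y;k)$, $R^{(1)}_0=0$. Put $y^{(+)}=\tfrac{n}{2J}\delta^hd+\tfrac\beta2(\tfrac\beta2-1)$, $y^{(1)}=\tfrac{n}{2J}d\delta^h+\tfrac\beta2(\tfrac\beta2+1)$. The Branson–Gover operator of order $2N$, $N\in\mathbb{N}$, on $p$-forms of the Einstein manifold is $$L^{(p)}_{2N}=(\tfrac{2J}{n})^N\Big[(\tfrac\beta2+N)R_N(y^{(+)};0)+(\tfrac\beta2-N)R^{(1)}_N(y^{(1)})\Big];$$ the critical one is the case $2N=n-2p$.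 For $J=0$ the expression is understood after multiplying out the powers of $\tfrac{2J}{n}$ (it is polynomial in $J$). *)

theory Defs
  imports "HOL-Analysis.Analysis" "HOL-Library.Function_Algebras"
begin

section \<open>Smooth maps between open subsets of normed spaces\<close>

text \<open>Meant for open \<open>S\<close>, where the derivatives at points of \<open>S\<close> do not depend on values outside
  \<open>S\<close>.\<close>

primrec Ck_on :: "nat \<Rightarrow> ('a::real_normed_vector \<Rightarrow> 'b::real_normed_vector) \<Rightarrow> 'a set \<Rightarrow> bool" where
  "Ck_on 0 f S \<longleftrightarrow> continuous_on S f"
| "Ck_on (Suc k) f S \<longleftrightarrow>
     f differentiable_on S \<and> (\<forall>v. Ck_on k (\<lambda>x. frechet_derivative f (at x) v) S)"

definition smooth_on :: "('a::real_normed_vector \<Rightarrow> 'b::real_normed_vector) \<Rightarrow> 'a set \<Rightarrow> bool" where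
  "smooth_on f S \<longleftrightarrow> (\<forall>k. Ck_on k f S)"

section \<open>Oriented manifolds\<close>

text \<open>The manifold is the whole type \<open>'m\<close> (Hausdorff, second countable), its smooth structure and
  orientation are given by an oriented atlas, not necessarily maximal. A chart is a pair of an open
  domain and a coordinate map; only the values of the map on the domain matter.\<close>

type_synonym ('m, 'n) chart = "'m set \<times> ('m \<Rightarrow> real ^ 'n)"

definition target :: "('m, 'n::finite) chart \<Rightarrow> (real ^ 'n) set" where
  "target c = snd c ` fst c"

definition is_chart :: "('m::topological_space, 'n::finite) chart \<Rightarrow> bool" where
  "is_chart c \<longleftrightarrow> open (fst c) \<and> open (target c) \<and>
     homeomorphism (fst c) (target c) (snd c) (inv_into (fst c) (snd c))"

definition overlap :: "('m, 'n::finite) chart \<Rightarrow> ('m, 'n) chart \<Rightarrow> (real ^ 'n) set" where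
  "overlap c c' = snd c ` (fst c \<inter> fst c')"

definition transition :: "('m, 'n::finite) chart \<Rightarrow> ('m, 'n) chart \<Rightarrow> real ^ 'n \<Rightarrow> real ^ 'n" where
  "transition c c' = snd c' \<circ> inv_into (fst c) (snd c)"

definition oriented_atlas :: "('m::topological_space, 'n::finite) chart set \<Rightarrow> bool" where
  "oriented_atlas A \<longleftrightarrow>
     (\<forall>c\<in>A. is_chart c) \<and> (\<Union>c\<in>A. fst c) = UNIV \<and>
     (\<forall>c\<in>A. \<forall>c'\<in>A. smooth_on (transition c c') (overlap c c') \<and>
        (\<forall>x\<in>overlap c c'. det (matrix (frechet_derivative (transition c c') (at x))) > 0))"

section \<open>Covariant tensor fields, differential forms, exterior derivative\<close>

text \<open>A covariant tensor field is the family of its coordinate representations: \<open>T c x vs\<close> is the value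
  at the point of the chart \<open>c\<close> with coordinates \<open>x\<close> on the tangent vectors whose components in
  \<open>c\<close> are listed in \<open>vs\<close>. Representations in different charts are related by pullback along
  the transition maps. All irrelevant values are 0, so equality of fields is equality of functions.\<close>

type_synonym ('m, 'n) tensor = "('m, 'n) chart \<Rightarrow> real ^ 'n \<Rightarrow> (real ^ 'n) list \<Rightarrow> real"

definition tensor_fields :: "('m, 'n::finite) chart set \<Rightarrow> nat \<Rightarrow> ('m, 'n) tensor set" where
  "tensor_fields A k = {T.
     (\<forall>c x vs. T c x vs \<noteq> 0 \<longrightarrow> c \<in> A \<and> x \<in> target c \<and> length vs = k) \<and>
     (\<forall>c\<in>A. \<forall>x\<in>target c. \<forall>vs. length vs = k \<longrightarrow> (\<forall>i<k. linear (\<lambda>v. T c x (vs[i := v])))) \<and>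
     (\<forall>c\<in>A. \<forall>vs. smooth_on (\<lambda>x. T c x vs) (target c)) \<and>
     (\<forall>c\<in>A. \<forall>c'\<in>A. \<forall>x\<in>overlap c c'. \<forall>vs.
        T c x vs =
        T c' (transition c c' x) (map (frechet_derivative (transition c c') (at x)) vs))}"

definition forms :: "('m, 'n::finite) chart set \<Rightarrow> nat \<Rightarrow> ('m, 'n) tensor set" where
  "forms A k = {\<omega> \<in> tensor_fields A k.
     \<forall>c x vs i j. i < j \<and> j < length vs \<and> vs ! i = vs ! j \<longrightarrow> \<omega> c x vs = 0}"

text \<open>Sums and differences of forms are the pointwise ones of \<^theory>\<open>HOL-Library.Function_Algebras\<close>.\<close>

definition scale_form :: "real \<Rightarrow> ('m, 'n) tensor \<Rightarrow> ('m, 'n) tensor"  (infixr "*\<^sub>f" 75) where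
  "a *\<^sub>f \<omega> = (\<lambda>c x vs. a * \<omega> c x vs)"

text \<open>In a chart, \<open>d\<omega>(v\<^sub>0,\<dots>,v\<^sub>k) = \<Sum>\<^sub>i (-1)\<^sup>i D\<omega>(v\<^sub>i)(v\<^sub>0,\<dots>,v\<^sub>k without v\<^sub>i)\<close> for
  constant vectors \<open>v\<^sub>i\<close>. The degree of \<open>\<omega>\<close> need not be given, it is determined by the
  length of the argument lists.\<close>

definition ext_deriv :: "('m, 'n::finite) chart set \<Rightarrow> ('m, 'n) tensor \<Rightarrow> ('m, 'n) tensor" where
  "ext_deriv A \<omega> = (\<lambda>c x vs.
     if c \<in> A \<and> x \<in> target c
     then \<Sum>i<length vs. (-1) ^ i *
            frechet_derivative (\<lambda>y. \<omega> c y (take i vs @ drop (Suc i) vs)) (at x) (vs ! i)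
     else 0)"

section \<open>Riemannian metrics and Ricci curvature\<close>

definition riemannian_metric :: "('m, 'n::finite) chart set \<Rightarrow> ('m, 'n) tensor \<Rightarrow> bool" where
  "riemannian_metric A h \<longleftrightarrow> h \<in> tensor_fields A 2 \<and>
     (\<forall>c\<in>A. \<forall>x\<in>target c.
        (\<forall>u v. h c x [u, v] = h c x [v, u]) \<and> (\<forall>v. v \<noteq> 0 \<longrightarrow> h c x [v, v] > 0))"

definition gram :: "('m, 'n::finite) tensor \<Rightarrow> ('m, 'n) chart \<Rightarrow> real ^ 'n \<Rightarrow> real ^ 'n ^ 'n" where
  "gram h c x = (\<chi> i j. h c x [axis i 1, axis j 1])"

definition inv_gram :: "('m, 'n::finite) tensor \<Rightarrow> ('m, 'n) chart \<Rightarrow> real ^ 'n \<Rightarrow> real ^ 'n ^ 'n" where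
  "inv_gram h c x = matrix_inv (gram h c x)"

definition partial :: "'n::finite \<Rightarrow> (real ^ 'n \<Rightarrow> real) \<Rightarrow> real ^ 'n \<Rightarrow> real" where
  "partial i f x = frechet_derivative f (at x) (axis i 1)"

text \<open>\<open>christoffel h c k i j x\<close> is the symbol of the Levi-Civita connection with upper index
  \<open>k\<close> and lower indices \<open>i, j\<close>.\<close>

definition christoffel ::
  "('m, 'n::finite) tensor \<Rightarrow> ('m, 'n) chart \<Rightarrow> 'n \<Rightarrow> 'n \<Rightarrow> 'n \<Rightarrow> real ^ 'n \<Rightarrow> real" where
  "christoffel h c k i j x = (1/2) * (\<Sum>l\<in>UNIV. inv_gram h c x $ k $ l *
     (partial i (\<lambda>y. gram h c y $ j $ l) x + partial j (\<lambda>y. gram h c y $ i $ l) x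
      - partial l (\<lambda>y. gram h c y $ i $ j) x))"

text \<open>\<open>riemann h c l k i j x\<close> is the component along \<open>\<partial>\<^sub>l\<close> of \<open>R(\<partial>\<^sub>i,\<partial>\<^sub>j)\<partial>\<^sub>k\<close>, where
  \<open>R(X,Y) = [\<nabla>\<^sub>X,\<nabla>\<^sub>Y] - \<nabla>\<^bsub>[X,Y]\<^esub>\<close>, and \<open>Ric(Y,Z)\<close> is the trace of \<open>X \<mapsto> R(X,Y)Z\<close>; round
  spheres have positive Ricci curvature.\<close>

definition riemann ::
  "('m, 'n::finite) tensor \<Rightarrow> ('m, 'n) chart \<Rightarrow> 'n \<Rightarrow> 'n \<Rightarrow> 'n \<Rightarrow> 'n \<Rightarrow> real ^ 'n \<Rightarrow> real" where
  "riemann h c l k i j x =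
     partial i (christoffel h c l j k) x - partial j (christoffel h c l i k) x
     + (\<Sum>m\<in>UNIV. christoffel h c l i m x * christoffel h c m j k x)
     - (\<Sum>m\<in>UNIV. christoffel h c l j m x * christoffel h c m i k x)"

definition ricci ::
  "('m, 'n::finite) tensor \<Rightarrow> ('m, 'n) chart \<Rightarrow> 'n \<Rightarrow> 'n \<Rightarrow> real ^ 'n \<Rightarrow> real" where
  "ricci h c j k x = (\<Sum>l\<in>UNIV. riemann h c l k l j x)"

definition einstein ::
  "('m, 'n::finite) chart set \<Rightarrow> ('m, 'n) tensor \<Rightarrow> real \<Rightarrow> bool" where
  "einstein A h J \<longleftrightarrow> (\<forall>c\<in>A. \<forall>x\<in>target c. \<forall>i j.
     ricci h c i j x = 2 * J / real CARD('n) * (real CARD('n) - 1) * gram h c x $ i $ j)"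

section \<open>The codifferential\<close>

text \<open>Normalised such that \<open>e\<^bsub>i\<^sub>1\<^esub> \<and> \<dots> \<and> e\<^bsub>i\<^sub>k\<^esub>\<close> with \<open>i\<^sub>1 < \<dots> < i\<^sub>k\<close> are orthonormal
  if the \<open>e\<^sub>i\<close> are, whence the factor \<open>1/k!\<close> in the sum over all multi-indices.\<close>

definition form_inner_coord ::
  "('m, 'n::finite) tensor \<Rightarrow> nat \<Rightarrow> ('m, 'n) tensor \<Rightarrow> ('m, 'n) tensor
    \<Rightarrow> ('m, 'n) chart \<Rightarrow> real ^ 'n \<Rightarrow> real" where
  "form_inner_coord h k \<alpha> \<beta> c x = (1 / fact k) *
     (\<Sum>is | length is = k. \<Sum>js | length js = k.
        (\<Prod>r<k. inv_gram h c x $ (is ! r) $ (js ! r)) *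
        \<alpha> c x (map (\<lambda>i. axis i 1) is) * \<beta> c x (map (\<lambda>j. axis j 1) js))"

text \<open>The value does not depend on the choice of a chart around the point.\<close>

definition form_inner ::
  "('m, 'n::finite) chart set \<Rightarrow> ('m, 'n) tensor \<Rightarrow> nat \<Rightarrow> ('m, 'n) tensor \<Rightarrow> ('m, 'n) tensor
    \<Rightarrow> 'm \<Rightarrow> real" where
  "form_inner A h k \<alpha> \<beta> q =
     (let c = (SOME c. c \<in> A \<and> q \<in> fst c) in form_inner_coord h k \<alpha> \<beta> c (snd c q))"

definition riemannian_volume ::
  "('m::topological_space, 'n::finite) chart set \<Rightarrow> ('m, 'n) tensor \<Rightarrow> 'm measure" where
  "riemannian_volume A h = (THE \<mu>. sets \<mu> = sets borel \<and>
     (\<forall>c\<in>A. \<forall>B\<in>sets borel. B \<subseteq> fst c \<longrightarrow>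
        emeasure \<mu> B =
        (\<integral>\<^sup>+ x. indicator (snd c ` B) x * ennreal (sqrt (det (gram h c x))) \<partial>lborel)))"

definition form_support ::
  "('m::topological_space, 'n::finite) chart set \<Rightarrow> ('m, 'n) tensor \<Rightarrow> 'm set" where
  "form_support A \<omega> = closure {q. \<exists>c\<in>A. q \<in> fst c \<and> (\<exists>vs. \<omega> c (snd c q) vs \<noteq> 0)}"

text \<open>\<open>\<delta>\<close> is the formal adjoint of \<open>d\<close> in all degrees at once. Since smooth compactly supported
  forms separate forms, it is uniquely determined on each space of forms.\<close>

definition codifferential ::
  "('m::topological_space, 'n::finite) chart set \<Rightarrow> ('m, 'n) tensor
    \<Rightarrow> (('m, 'n) tensor \<Rightarrow> ('m, 'n) tensor) \<Rightarrow> bool" where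
  "codifferential A h \<delta> \<longleftrightarrow>
     (\<forall>f\<in>forms A 0. \<delta> f = 0) \<and>
     (\<forall>k. \<forall>\<beta>\<in>forms A (Suc k). \<delta> \<beta> \<in> forms A k) \<and>
     (\<forall>k. \<forall>\<beta>\<in>forms A k. \<forall>\<gamma>\<in>forms A k. \<delta> (\<beta> + \<gamma>) = \<delta> \<beta> + \<delta> \<gamma>) \<and>
     (\<forall>k a. \<forall>\<beta>\<in>forms A k. \<delta> (a *\<^sub>f \<beta>) = a *\<^sub>f \<delta> \<beta>) \<and>
     (\<forall>k. \<forall>\<alpha>\<in>forms A k. \<forall>\<beta>\<in>forms A (Suc k). compact (form_support A \<alpha>) \<longrightarrow>
        (\<integral>q. form_inner A h (Suc k) (ext_deriv A \<alpha>) \<beta> q \<partial>riemannian_volume A h) =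
        (\<integral>q. form_inner A h k \<alpha> (\<delta> \<beta>) q \<partial>riemannian_volume A h))"

section \<open>Branson--Gover operators\<close>

type_synonym ('m, 'n) form_op = "('m, 'n) tensor \<Rightarrow> ('m, 'n) tensor"

text \<open>\<open>add_const y a\<close> is the operator \<open>y + a\<close>, and \<open>op_prod F k = F 1 \<circ> \<dots> \<circ> F k\<close>.\<close>

definition add_const :: "('m, 'n) form_op \<Rightarrow> real \<Rightarrow> ('m, 'n) form_op" where
  "add_const y a = (\<lambda>\<omega>. y \<omega> + a *\<^sub>f \<omega>)"

primrec op_prod :: "(nat \<Rightarrow> 'a \<Rightarrow> 'a) \<Rightarrow> nat \<Rightarrow> 'a \<Rightarrow> 'a" where
  "op_prod F 0 = id"
| "op_prod F (Suc k) = op_prod F k \<circ> F (Suc k)"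

definition R_op :: "nat \<Rightarrow> real \<Rightarrow> ('m, 'n) form_op \<Rightarrow> ('m, 'n) form_op" where
  "R_op k \<alpha> y = op_prod (\<lambda>l. add_const y (- ((\<alpha> - real l) * (\<alpha> - real l + 1)))) k"

definition R1_op :: "real \<Rightarrow> nat \<Rightarrow> ('m, 'n) form_op \<Rightarrow> ('m, 'n) form_op" where
  "R1_op \<beta> k y = (\<lambda>\<omega>. \<Sum>j=1..k. pochhammer (\<beta>/2 - real k + real j + 1) (2 * (k - j)) *\<^sub>f
     add_const y (- (\<beta>/2 * (\<beta>/2 + 1))) (R_op (j - 1) (real k) y \<omega>))"

text \<open>The same with the powers of \<open>t = 2J/n\<close> multiplied out: for \<open>Y = t y\<close>, these are
  \<open>t\<^sup>k R\<^sub>k(y;\<alpha>)\<close> and \<open>t\<^sup>k R\<^sup>(\<^sup>1\<^sup>)\<^sub>k(y)\<close> written as polynomials in \<open>t\<close> and \<open>Y\<close>; see the lemmas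
  below.\<close>

definition R_cleared :: "real \<Rightarrow> nat \<Rightarrow> real \<Rightarrow> ('m, 'n) form_op \<Rightarrow> ('m, 'n) form_op" where
  "R_cleared t k \<alpha> Y = op_prod (\<lambda>l. add_const Y (- (t * ((\<alpha> - real l) * (\<alpha> - real l + 1))))) k"

definition R1_cleared :: "real \<Rightarrow> real \<Rightarrow> nat \<Rightarrow> ('m, 'n) form_op \<Rightarrow> ('m, 'n) form_op" where
  "R1_cleared t \<beta> k Y = (\<lambda>\<omega>. \<Sum>j=1..k.
     (pochhammer (\<beta>/2 - real k + real j + 1) (2 * (k - j)) * t ^ (k - j)) *\<^sub>f
     add_const Y (- (t * (\<beta>/2 * (\<beta>/2 + 1)))) (R_cleared t (j - 1) (real k) Y \<omega>))"

text \<open>The operator of order \<open>2N\<close> on \<open>p\<close>-forms. The second branch also makes sense for \<open>J \<noteq> 0\<close>,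
  where it agrees with the first one.\<close>

definition branson_gover ::
  "('m, 'n::finite) chart set \<Rightarrow> ('m, 'n) form_op \<Rightarrow> real \<Rightarrow> nat \<Rightarrow> nat \<Rightarrow> ('m, 'n) form_op" where
  "branson_gover A \<delta> J p N =
    (let n = real CARD('n); \<beta> = n - 2 * real p; d = ext_deriv A in
     if J \<noteq> 0 then
       (let y_plus = add_const (\<lambda>\<omega>. (n / (2 * J)) *\<^sub>f \<delta> (d \<omega>)) (\<beta>/2 * (\<beta>/2 - 1));
            y_one = add_const (\<lambda>\<omega>. (n / (2 * J)) *\<^sub>f d (\<delta> \<omega>)) (\<beta>/2 * (\<beta>/2 + 1))
        in (\<lambda>\<omega>. ((2 * J / n) ^ N) *\<^sub>f
              ((\<beta>/2 + real N) *\<^sub>f R_op N 0 y_plus \<omega> + (\<beta>/2 - real N) *\<^sub>f R1_op \<beta> N y_one \<omega>)))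
     else
       (let t = 2 * J / n;
            Y_plus = add_const (\<lambda>\<omega>. \<delta> (d \<omega>)) (t * (\<beta>/2 * (\<beta>/2 - 1)));
            Y_one = add_const (\<lambda>\<omega>. d (\<delta> \<omega>)) (t * (\<beta>/2 * (\<beta>/2 + 1)))
        in (\<lambda>\<omega>. (\<beta>/2 + real N) *\<^sub>f R_cleared t N 0 Y_plus \<omega>
              + (\<beta>/2 - real N) *\<^sub>f R1_cleared t \<beta> N Y_one \<omega>)))"

lemma scale_form_simps [simp]:
  "a *\<^sub>f b *\<^sub>f \<omega> = (a * b) *\<^sub>f \<omega>" "1 *\<^sub>f \<omega> = \<omega>"
  "a *\<^sub>f (\<omega> + \<eta>) = a *\<^sub>f \<omega> + a *\<^sub>f \<eta>"
  by (simp_all add: scale_form_def fun_eq_iff plus_fun_def algebra_simps)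

lemma scale_form_sum: "a *\<^sub>f (\<Sum>i\<in>I. f i) = (\<Sum>i\<in>I. a *\<^sub>f f i)"
proof -
  have "a *\<^sub>f (0 :: ('m, 'n) tensor) = 0" by (simp add: scale_form_def fun_eq_iff zero_fun_def)
  then show ?thesis by (induction I rule: infinite_finite_induct) auto
qed

lemma R_cleared_eq:
  assumes "\<omega> \<in> V" and V: "\<And>a \<eta>. \<eta> \<in> V \<Longrightarrow> a *\<^sub>f \<eta> \<in> V" "\<And>\<eta> \<zeta>. \<eta> \<in> V \<Longrightarrow> \<zeta> \<in> V \<Longrightarrow> \<eta> + \<zeta> \<in> V"
    and y: "\<And>\<eta>. \<eta> \<in> V \<Longrightarrow> y \<eta> \<in> V" "\<And>a \<eta>. \<eta> \<in> V \<Longrightarrow> y (a *\<^sub>f \<eta>) = a *\<^sub>f y \<eta>"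
  shows "R_cleared t k \<alpha> (\<lambda>\<eta>. t *\<^sub>f y \<eta>) \<omega> = (t ^ k) *\<^sub>f R_op k \<alpha> y \<omega>"
proof -
  have hom: "R_op k \<alpha> y (a *\<^sub>f \<omega>) = a *\<^sub>f R_op k \<alpha> y \<omega>" if "\<omega> \<in> V" for k a \<omega>
    using that
  proof (induction k arbitrary: \<omega>)
    case (Suc k)
    have "add_const y b \<omega> \<in> V" for b using Suc.prems V y by (simp add: add_const_def)
    moreover have "add_const y b (a *\<^sub>f \<omega>) = a *\<^sub>f add_const y b \<omega>" for b
      using Suc.prems y by (simp add: add_const_def mult.commute)
    ultimately show ?case using Suc.IH by (simp add: R_op_def)
  qed (simp add: R_op_def)
  show ?thesis using \<open>\<omega> \<in> V\<close>
  proof (induction k arbitrary: \<omega>)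
    case (Suc k)
    let ?b = "- ((\<alpha> - real (Suc k)) * (\<alpha> - real (Suc k) + 1))"
    have mem: "add_const y ?b \<omega> \<in> V" using Suc.prems V y by (simp add: add_const_def)
    have "add_const (\<lambda>\<eta>. t *\<^sub>f y \<eta>) (- (t * ((\<alpha> - real (Suc k)) * (\<alpha> - real (Suc k) + 1)))) \<omega>
        = t *\<^sub>f add_const y ?b \<omega>" by (simp add: add_const_def)
    then have "R_cleared t (Suc k) \<alpha> (\<lambda>\<eta>. t *\<^sub>f y \<eta>) \<omega>
        = R_cleared t k \<alpha> (\<lambda>\<eta>. t *\<^sub>f y \<eta>) (t *\<^sub>f add_const y ?b \<omega>)"
      by (simp add: R_cleared_def)
    also have "\<dots> = (t ^ k) *\<^sub>f R_op k \<alpha> y (t *\<^sub>f add_const y ?b \<omega>)"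
      using Suc.IH V(1)[OF mem] by blast
    also have "\<dots> = (t ^ Suc k) *\<^sub>f R_op (Suc k) \<alpha> y \<omega>"
      using hom[OF mem] by (simp add: R_op_def mult.commute)
    finally show ?case .
  qed (simp add: R_cleared_def R_op_def)
qed

lemma R1_cleared_eq:
  assumes "\<omega> \<in> V" and "\<And>a \<eta>. \<eta> \<in> V \<Longrightarrow> a *\<^sub>f \<eta> \<in> V" "\<And>\<eta> \<zeta>. \<eta> \<in> V \<Longrightarrow> \<zeta> \<in> V \<Longrightarrow> \<eta> + \<zeta> \<in> V"
    and "\<And>\<eta>. \<eta> \<in> V \<Longrightarrow> y \<eta> \<in> V" "\<And>a \<eta>. \<eta> \<in> V \<Longrightarrow> y (a *\<^sub>f \<eta>) = a *\<^sub>f y \<eta>"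
  shows "R1_cleared t \<beta> k (\<lambda>\<eta>. t *\<^sub>f y \<eta>) \<omega> = (t ^ k) *\<^sub>f R1_op \<beta> k y \<omega>"
proof -
  have mem: "R_op i \<alpha> y \<eta> \<in> V" if "\<eta> \<in> V" for i \<alpha> \<eta>
    using that
    by (induction i arbitrary: \<eta>) (simp_all add: R_op_def add_const_def assms)
  have "(t ^ (k - j)) *\<^sub>f add_const (\<lambda>\<eta>. t *\<^sub>f y \<eta>) (- (t * a)) (R_cleared t (j - 1) \<alpha> (\<lambda>\<eta>. t *\<^sub>f y \<eta>) \<omega>)
      = (t ^ k) *\<^sub>f add_const y (- a) (R_op (j - 1) \<alpha> y \<omega>)" if "j \<in> {1..k}" for j a \<alpha>
  proof -
    have "t ^ k = t ^ (k - j) * (t * t ^ (j - 1))"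
      using that by (simp flip: power_Suc power_add)
    then show ?thesis
      by (simp add: R_cleared_eq[OF assms] add_const_def assms mem mult_ac)
  qed
  then have *: "(b * t ^ (k - j)) *\<^sub>f
        add_const (\<lambda>\<eta>. t *\<^sub>f y \<eta>) (- (t * a)) (R_cleared t (j - 1) \<alpha> (\<lambda>\<eta>. t *\<^sub>f y \<eta>) \<omega>)
      = (t ^ k) *\<^sub>f b *\<^sub>f add_const y (- a) (R_op (j - 1) \<alpha> y \<omega>)" if "j \<in> {1..k}" for j a b \<alpha>
    unfolding scale_form_simps(1)[symmetric, of b] using that
    by (simp only: scale_form_simps(1) mult.commute)
  show ?thesis
    unfolding R1_cleared_def R1_op_def scale_form_sum by (intro sum.cong refl *)
qed

end

theory Submission
  imports Defs
begin

text \<open>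
  In the critical case \<open>N = (n - 2p)/2 = \<beta>/2\<close>, the coefficient \<open>\<beta>/2 - N\<close> of the second part of
  the Branson--Gover operator is 0. With \<open>t = 2J/n\<close> and \<open>D = \<delta>d\<close>, the first part is
  \<open>2N\<close> times the product over \<open>l = 1, \<dots>, N\<close> of
  \<open>D + t ((\<beta>/2)(\<beta>/2 - 1) - l (l - 1)) = D + t (\<beta>/2 - l)(\<beta>/2 + l - 1)\<close>. The factor
  with \<open>l = N\<close> is \<open>D\<close> itself and commutes with the others, because \<open>D\<close> is linear on
  \<open>p\<close>-forms.

  The algebra needs \<open>D\<close> to map \<open>p\<close>-forms linearly to \<open>p\<close>-forms. As \<open>\<delta>\<close> is only given
  on forms, the point is that \<open>d\<close>, given by a formula in each chart, maps forms to forms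
  (\<open>ext_deriv_in_forms\<close>). The substantial part is the compatibility with coordinate changes
  (\<open>ext_deriv_transition\<close>). The product rule for a multilinear map applied to moving vectors
  (\<open>has_derivative_multilinear\<close>) produces, besides the expected terms, the second derivative of the
  coordinate change inserted into the form. It is symmetric (\<open>symmetric_second_derivative\<close>), while the
  form is alternating, so these terms cancel in pairs (\<open>symmetric_insertions_cancel\<close>).
\<close>

section \<open>Alternating multilinear maps on lists of vectors\<close>

definition multilinear :: "nat \<Rightarrow> ('v::real_vector list \<Rightarrow> real) \<Rightarrow> bool" where
  "multilinear k F \<longleftrightarrow> (\<forall>vs. length vs = k \<longrightarrow> (\<forall>i<k. linear (\<lambda>v. F (vs[i := v]))))"

definition omit :: "nat \<Rightarrow> 'a list \<Rightarrow> 'a list" where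
  "omit i vs = take i vs @ drop (Suc i) vs"

lemma length_omit [simp]: "i < length vs \<Longrightarrow> length (omit i vs) = length vs - 1"
  by (simp add: omit_def)

lemma nth_omit:
  "i < length vs \<Longrightarrow> m < length vs - 1 \<Longrightarrow> omit i vs ! m = vs ! (if m < i then m else Suc m)"
  by (auto simp: omit_def nth_append)

lemma map_omit: "map f (omit i vs) = omit i (map f vs)"
  by (simp add: omit_def take_map drop_map)

lemma omit_update_same: "omit i (vs[i := v]) = omit i vs"
  by (simp add: omit_def)

lemma omit_update_other:
  assumes "i < length vs" "j < length vs" "i \<noteq> j"
  shows "omit i (vs[j := v]) = (omit i vs)[(if j < i then j else j - 1) := v]"
  using assms by (intro nth_equalityI) (auto simp: nth_omit nth_list_update)

lemma linear_arg:
  assumes "multilinear k F" "length xs + Suc (length ys) = k"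
  shows "linear (\<lambda>v. F (xs @ v # ys))"
proof -
  have "length (xs @ undefined # ys) = k" "length xs < k" using assms(2) by auto
  then have "linear (\<lambda>v. F ((xs @ undefined # ys)[length xs := v]))"
    using assms(1) unfolding multilinear_def by blast
  then show ?thesis by simp
qed

text \<open>It is enough that \<open>F\<close> vanishes on lists with two equal neighbours: expanding
  \<open>F (\<dots>, a + b, a + b, \<dots>) = 0\<close> shows that \<open>F\<close> changes sign under the exchange of neighbours, and
  any entry can be moved by such exchanges.\<close>

lemma alternating_move:
  assumes ml: "multilinear k F"
    and adj: "\<And>xs a ys. length xs + Suc (Suc (length ys)) = k \<Longrightarrow> F (xs @ a # a # ys) = 0"
    and len: "length xs + Suc (length ys + length zs) = k"
  shows "F (xs @ a # ys @ zs) = (-1) ^ length ys * F (xs @ ys @ a # zs)"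
  using len
proof (induction ys arbitrary: xs)
  case (Cons b ys)
  let ?ws = "ys @ zs"
  have len: "length xs + Suc (Suc (length ?ws)) = k" using Cons.prems by simp
  have add1: "F (xs @ (u + v) # w # ?ws) = F (xs @ u # w # ?ws) + F (xs @ v # w # ?ws)" for u v w
    using linear_add[OF linear_arg[OF ml, of xs "w # ?ws"]] len by simp
  have add2: "F (xs @ w # (u + v) # ?ws) = F (xs @ w # u # ?ws) + F (xs @ w # v # ?ws)" for u v w
    using linear_add[OF linear_arg[OF ml, of "xs @ [w]" "?ws"]] len by simp
  have "F (xs @ (a + b) # (a + b) # ?ws) = 0" using adj len by blast
  then have "F (xs @ a # b # ?ws) = - F (xs @ b # a # ?ws)"
    unfolding add1 add2 using adj[OF len, of a] adj[OF len, of b] by simp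
  also have "F (xs @ b # a # ?ws) = (-1) ^ length ys * F (xs @ b # ys @ a # zs)"
    using Cons.IH[of "xs @ [b]"] Cons.prems by simp
  finally show ?case by simp
qed simp

lemma split_at_two:
  assumes "i < j" "j < length vs"
  obtains xs ys zs where "vs = xs @ vs ! i # ys @ vs ! j # zs" "length xs = i" "length ys = j - i - 1"
proof
  have "drop (Suc i) vs = take (j - i - 1) (drop (Suc i) vs) @ vs ! j # drop (Suc j) vs"
    using assms id_take_nth_drop[of "j - i - 1" "drop (Suc i) vs"] by simp
  then show "vs = take i vs @ vs ! i # take (j - i - 1) (drop (Suc i) vs) @ vs ! j # drop (Suc j) vs"
    using assms id_take_nth_drop[of i vs] by simp
qed (use assms in auto)

lemma alternating_if_adjacent:
  assumes "multilinear k F"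
    and adj: "\<And>xs a ys. length xs + Suc (Suc (length ys)) = k \<Longrightarrow> F (xs @ a # a # ys) = 0"
    and "length vs = k" "i < j" "j < k" "vs ! i = vs ! j"
  shows "F vs = 0"
proof -
  obtain xs ys zs a where vs: "vs = xs @ a # ys @ a # zs"
    using split_at_two[of i j vs] assms(3-6) by metis
  then have len: "length xs + Suc (length ys + length (a # zs)) = k" using assms(3) by simp
  have "F vs = (-1) ^ length ys * F (xs @ ys @ a # a # zs)"
    unfolding vs by (rule alternating_move[OF assms(1) adj len])
  then show ?thesis using adj[of "xs @ ys" zs a] len by simp
qed

text \<open>Removing the entry \<open>i\<close> and writing \<open>H\<close> at the old position \<open>j < i\<close> gives, up to the sign
  \<open>(-1)\<^sup>i\<^sup>-\<^sup>j\<^sup>-\<^sup>1\<close> of moving \<open>H\<close>, the same as removing \<open>j\<close> and writing \<open>H\<close> at the old position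
  \<open>i\<close>. With the alternating signs, the two terms cancel if \<open>H\<close> is symmetric in \<open>i, j\<close>. This is
  what kills the second derivatives of a coordinate change in the pullback of an exterior derivative.\<close>

lemma symmetric_insertions_cancel:
  fixes F :: "'v::real_vector list \<Rightarrow> real"
  assumes ml: "multilinear k F"
    and alt: "\<And>vs i j. length vs = k \<Longrightarrow> i < j \<Longrightarrow> j < k \<Longrightarrow> vs ! i = vs ! j \<Longrightarrow> F vs = 0"
    and sym: "\<And>i j. B i j = B j i"
    and len: "length ws = Suc k"
  shows "(\<Sum>i<Suc k. (-1) ^ i * (\<Sum>m<k. F ((omit i ws)[m := B i (if m < i then m else Suc m)]))) = 0"
proof -
  define T where "T i m = (-1) ^ i * F ((omit i ws)[m := B i (if m < i then m else Suc m)])" for i m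
  have adj: "F (xs @ a # a # ys) = 0" if "length xs + Suc (Suc (length ys)) = k" for xs a ys
    by (rule alt[of _ "length xs" "Suc (length xs)"]) (use that in \<open>auto simp: nth_append\<close>)
  have pair: "T i m = - T m (i - 1)" if "m < i" "i < Suc k" for i m
  proof -
    have bounds: "m < i" "i < length ws" using that len by auto
    obtain xs ys zs where ws: "ws = xs @ ws ! m # ys @ ws ! i # zs"
      and l: "length xs = m" "length ys = i - m - 1"
      by (rule split_at_two[OF bounds])
    have tot: "length xs + Suc (length ys + length zs) = k"
      using arg_cong[OF ws, of length] len by simp
    have i: "i = Suc (length xs + length ys)" using l that by simp
    define a b H where "a = ws ! m" "b = ws ! i" "H = B i m"
    have ws': "ws = xs @ a # ys @ b # zs" using ws by (simp add: a_b_H_def)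
    have "(omit i ws)[m := H] = xs @ H # ys @ zs"
      unfolding ws' i l(1)[symmetric] by (simp add: omit_def list_update_append)
    moreover have "(omit m ws)[i - 1 := H] = xs @ ys @ H # zs"
      unfolding ws' i l(1)[symmetric] by (simp add: omit_def list_update_append)
    moreover have "F (xs @ H # ys @ zs) = (-1) ^ length ys * F (xs @ ys @ H # zs)"
      by (rule alternating_move[OF ml adj tot])
    moreover have "B m i = H" using sym by (simp add: a_b_H_def)
    moreover have "(-1::real) ^ i * (-1) ^ length ys = - ((-1) ^ m)"
      by (simp add: i l(1)[symmetric] power_add flip: power_mult_distrib)
    moreover have "\<not> i - 1 < m" "Suc (i - 1) = i" using that by auto
    ultimately show ?thesis
      using that by (simp add: T_def a_b_H_def flip: mult.assoc)
  qed
  \<comment> \<open>The pairs below the diagonal are matched with the others by \<open>(i, m) \<mapsto> (m, i - 1)\<close>.\<close>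
  let ?U = "{(i, m). m < i \<and> i < Suc k}" and ?L = "{(i, m). i \<le> m \<and> m < k}"
  have "(\<Sum>i<Suc k. \<Sum>m<k. T i m) = sum (case_prod T) ({..<Suc k} \<times> {..<k})"
    by (simp add: sum.cartesian_product del: sum.lessThan_Suc)
  also have "\<dots> = sum (case_prod T) (?U \<union> ?L)"
    by (rule arg_cong[where f = "sum _"]) auto
  also have "\<dots> = sum (case_prod T) ?U + sum (case_prod T) ?L"
    by (intro sum.union_disjoint finite_subset[of ?U "{..<Suc k} \<times> {..<k}"]
        finite_subset[of ?L "{..<Suc k} \<times> {..<k}"]) auto
  also have "sum (case_prod T) ?L = sum (\<lambda>(i, m). T m (i - 1)) ?U"
    by (rule sum.reindex_bij_witness[where i = "\<lambda>(i, m). (m, i - 1)" and j = "\<lambda>(i, m). (Suc m, i)"]) auto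
  also have "sum (case_prod T) ?U = - sum (\<lambda>(i, m). T m (i - 1)) ?U"
    unfolding sum_negf[symmetric] by (rule sum.cong) (use pair in auto)
  finally show ?thesis by (simp add: T_def sum_distrib_left del: sum.lessThan_Suc)
qed

section \<open>Calculus of smooth functions\<close>

lemma differentiable_onD_open: "f differentiable_on S \<Longrightarrow> open S \<Longrightarrow> x \<in> S \<Longrightarrow> f differentiable (at x)"
  by (simp add: differentiable_on_eq_differentiable_at)

lemma Ck_on_cong:
  assumes "open S" "\<And>x. x \<in> S \<Longrightarrow> f x = g x" "Ck_on k f S"
  shows "Ck_on k g S"
  using assms(2,3)
proof (induction k arbitrary: f g)
  case 0
  then show ?case using continuous_on_eq by (metis Ck_on.simps(1))
next
  case (Suc k)
  then have f: "f differentiable_on S" and f': "\<And>v. Ck_on k (\<lambda>x. frechet_derivative f (at x) v) S"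
    by simp_all
  have "frechet_derivative f (at x) = frechet_derivative g (at x)" if "x \<in> S" for x
    by (rule frechet_derivative_transform_within_open[OF _ assms(1) that Suc.prems(1)])
       (use differentiable_onD_open[OF f assms(1) that] in auto)
  then have "Ck_on k (\<lambda>x. frechet_derivative g (at x) v) S" for v
    using Suc.IH[OF _ f'] by simp
  moreover have "g differentiable_on S"
    using f differentiable_transform_within[OF _ zero_less_one, of f _ S g] Suc.prems(1)
    unfolding differentiable_on_def by auto
  ultimately show ?case by simp
qed

text \<open>In a chart, the exterior derivative is a combination, with constant coefficients, of
  directional derivatives of components of the form. So linear combinations suffice for its
  smoothness.\<close>

lemma Ck_on_lincomb:
  fixes f g :: "'a::real_normed_vector \<Rightarrow> real"
  assumes "open S" "Ck_on k f S" "Ck_on k g S"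
  shows "Ck_on k (\<lambda>x. a * f x + b * g x) S"
  using assms(2,3)
proof (induction k arbitrary: f g)
  case 0
  then show ?case by (auto intro!: continuous_intros)
next
  case (Suc k)
  let ?D = "\<lambda>f x. frechet_derivative f (at x)"
  have f: "f differentiable_on S" and f': "\<And>v. Ck_on k (\<lambda>x. ?D f x v) S"
    and g: "g differentiable_on S" and g': "\<And>v. Ck_on k (\<lambda>x. ?D g x v) S"
    using Suc.prems by simp_all
  have "?D (\<lambda>x. a * f x + b * g x) x = (\<lambda>v. a * ?D f x v + b * ?D g x v)" if "x \<in> S" for x
    by (rule sym, rule frechet_derivative_at, intro derivative_intros)
       (use f g assms(1) that in \<open>auto dest: differentiable_onD_open simp: frechet_derivative_works\<close>)
  then have "Ck_on k (\<lambda>x. ?D (\<lambda>x. a * f x + b * g x) x v) S" for v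
    by (intro Ck_on_cong[OF assms(1) _ Suc.IH[OF f' g', of v v]]) auto
  moreover have "(\<lambda>x. a * f x + b * g x) differentiable_on S"
    using f g by (auto intro!: derivative_intros)
  ultimately show ?case by simp
qed

lemma smooth_on_cong: "open S \<Longrightarrow> (\<And>x. x \<in> S \<Longrightarrow> f x = g x) \<Longrightarrow> smooth_on f S \<Longrightarrow> smooth_on g S"
  unfolding smooth_on_def using Ck_on_cong by metis

lemma smooth_on_lincomb:
  fixes f g :: "'a::real_normed_vector \<Rightarrow> real"
  shows "open S \<Longrightarrow> smooth_on f S \<Longrightarrow> smooth_on g S \<Longrightarrow> smooth_on (\<lambda>x. a * f x + b * g x) S"
  unfolding smooth_on_def using Ck_on_lincomb by blast

lemma smooth_on_zero: "smooth_on (\<lambda>x. 0 :: 'b::real_normed_vector) S"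
proof -
  have "Ck_on k (\<lambda>x. 0 :: 'b) S" for k by (induction k) simp_all
  then show ?thesis by (simp add: smooth_on_def)
qed

lemma smooth_on_sum_scaled:
  fixes f :: "'i \<Rightarrow> 'a::real_normed_vector \<Rightarrow> real"
  assumes "open S" "finite I" "\<And>i. i \<in> I \<Longrightarrow> smooth_on (f i) S"
  shows "smooth_on (\<lambda>x. \<Sum>i\<in>I. c i * f i x) S"
  using assms(2,3)
proof (induction I)
  case (insert i I)
  then show ?case using smooth_on_lincomb[OF assms(1), of "f i" _ "c i" 1] by simp
qed (simp add: smooth_on_zero)

lemma smooth_on_derivative: "smooth_on f S \<Longrightarrow> smooth_on (\<lambda>x. frechet_derivative f (at x) v) S"
  unfolding smooth_on_def by (metis Ck_on.simps(2))

lemma smooth_on_has_derivative: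
  assumes "smooth_on f S" "open S" "x \<in> S"
  shows "(f has_derivative frechet_derivative f (at x)) (at x)"
proof -
  have "f differentiable_on S" using assms(1) unfolding smooth_on_def by (metis Ck_on.simps(2))
  then show ?thesis using assms differentiable_onD_open frechet_derivative_works by blast
qed

lemma smooth_on_continuous: "smooth_on f S \<Longrightarrow> continuous_on S f"
  unfolding smooth_on_def by (metis Ck_on.simps(1))

text \<open>Two applications of the mean value theorem to the second difference of \<open>f\<close>. Its value is
  symmetric in \<open>v\<close> and \<open>w\<close>, which gives the symmetry of second derivatives.\<close>

lemma second_difference:
  fixes f :: "'a::real_normed_vector \<Rightarrow> real"
  assumes "0 < s" and sub: "\<And>r q. 0 \<le> r \<Longrightarrow> r \<le> s \<Longrightarrow> 0 \<le> q \<Longrightarrow> q \<le> s \<Longrightarrow> x + r *\<^sub>R v + q *\<^sub>R w \<in> S"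
    and f: "\<And>y. y \<in> S \<Longrightarrow> (f has_derivative f' y) (at y)"
    and f': "\<And>y. y \<in> S \<Longrightarrow> ((\<lambda>y. f' y v) has_derivative f'' y) (at y)"
  shows "\<exists>r\<in>{0..s}. \<exists>q\<in>{0..s}.
    f (x + s *\<^sub>R v + s *\<^sub>R w) - f (x + s *\<^sub>R v) - f (x + s *\<^sub>R w) + f x
      = s * s * f'' (x + r *\<^sub>R v + q *\<^sub>R w) w"
proof -
  have lin: "linear (f' y)" "linear (f'' y)" if "y \<in> S" for y
    using f[OF that] f'[OF that] by (simp_all add: has_derivative_linear)
  have sub0: "x + r *\<^sub>R v \<in> S" if "0 \<le> r" "r \<le> s" for r
    using sub[of r 0] that assms(1) by simp
  let ?\<phi> = "\<lambda>r. f (x + r *\<^sub>R v + s *\<^sub>R w) - f (x + r *\<^sub>R v)"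
  have "\<exists>r\<in>{0..s}. ?\<phi> s - ?\<phi> 0
      = (\<lambda>r u. f' (x + r *\<^sub>R v + s *\<^sub>R w) (u *\<^sub>R v) - f' (x + r *\<^sub>R v) (u *\<^sub>R v)) r (s - 0)"
    using assms(1) sub sub0
    by (intro mvt_very_simple has_derivative_diff)
       (auto intro!: has_derivative_compose[of "\<lambda>r. x + r *\<^sub>R v + s *\<^sub>R w" "\<lambda>u. u *\<^sub>R v" _ _ f]
          has_derivative_compose[of "\<lambda>r. x + r *\<^sub>R v" "\<lambda>u. u *\<^sub>R v" _ _ f] f
          derivative_eq_intros)
  then obtain r where r: "r \<in> {0..s}" and
    "?\<phi> s - ?\<phi> 0 = f' (x + r *\<^sub>R v + s *\<^sub>R w) (s *\<^sub>R v) - f' (x + r *\<^sub>R v) (s *\<^sub>R v)"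
    by auto
  then have 1: "?\<phi> s - ?\<phi> 0 = s * (f' (x + r *\<^sub>R v + s *\<^sub>R w) v - f' (x + r *\<^sub>R v) v)"
    using lin sub sub0 assms(1) by (simp add: linear_cmul algebra_simps)
  have "\<exists>q\<in>{0..s}. f' (x + r *\<^sub>R v + s *\<^sub>R w) v - f' (x + r *\<^sub>R v + 0 *\<^sub>R w) v
      = (\<lambda>q u. f'' (x + r *\<^sub>R v + q *\<^sub>R w) (u *\<^sub>R w)) q (s - 0)"
    using assms(1) r sub
    by (intro mvt_very_simple)
       (auto intro!: has_derivative_compose[of "\<lambda>q. x + r *\<^sub>R v + q *\<^sub>R w" "\<lambda>u. u *\<^sub>R w" _ _ "\<lambda>y. f' y v"] f'
          derivative_eq_intros)
  then obtain q where q: "q \<in> {0..s}" and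
    "f' (x + r *\<^sub>R v + s *\<^sub>R w) v - f' (x + r *\<^sub>R v) v = f'' (x + r *\<^sub>R v + q *\<^sub>R w) (s *\<^sub>R w)"
    by auto
  then have "f' (x + r *\<^sub>R v + s *\<^sub>R w) v - f' (x + r *\<^sub>R v) v = s * f'' (x + r *\<^sub>R v + q *\<^sub>R w) w"
    using lin sub r by (simp add: linear_cmul)
  with 1 r q show ?thesis by (intro bexI[of _ r] bexI[of _ q]) (auto simp: algebra_simps)
qed

lemma symmetric_second_derivative_real:
  fixes f :: "'a::real_normed_vector \<Rightarrow> real"
  assumes "open S" "x \<in> S"
    and f: "\<And>y. y \<in> S \<Longrightarrow> (f has_derivative f' y) (at y)"
    and f': "\<And>y u. y \<in> S \<Longrightarrow> ((\<lambda>y. f' y u) has_derivative f'' u y) (at y)"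
    and cont: "\<And>u u'. continuous_on S (\<lambda>y. f'' u y u')"
  shows "f'' v x w = f'' w x v"
proof (rule ccontr)
  assume ne: "f'' v x w \<noteq> f'' w x v"
  define e where "e = \<bar>f'' v x w - f'' w x v\<bar> / 2"
  have e: "e > 0" using ne by (simp add: e_def)
  obtain d0 where d0: "d0 > 0" "ball x d0 \<subseteq> S" using assms(1,2) openE by blast
  have near: "\<exists>d>0. \<forall>y. dist y x < d \<longrightarrow> y \<in> S \<and> \<bar>f'' u y u' - f'' u x u'\<bar> < e" for u u'
  proof -
    have "isCont (\<lambda>y. f'' u y u') x"
      using cont assms(1,2) continuous_on_eq_continuous_at by blast
    then obtain d1 where "d1 > 0" "\<forall>y. dist y x < d1 \<longrightarrow> \<bar>f'' u y u' - f'' u x u'\<bar> < e"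
      using e unfolding continuous_at_eps_delta dist_real_def by blast
    then show ?thesis using d0
      by (intro exI[of _ "min d0 d1"]) (auto simp: dist_commute)
  qed
  obtain da where da: "da > 0" "\<And>y. dist y x < da \<Longrightarrow> y \<in> S \<and> \<bar>f'' v y w - f'' v x w\<bar> < e"
    using near by meson
  obtain db where db: "db > 0" "\<And>y. dist y x < db \<Longrightarrow> y \<in> S \<and> \<bar>f'' w y v - f'' w x v\<bar> < e"
    using near by meson
  \<comment> \<open>So small that the parallelogram at \<open>x\<close> spanned by \<open>s v\<close> and \<open>s w\<close> lies where both second
    derivatives differ from their values at \<open>x\<close> by less than \<open>e\<close>.\<close>
  define s where "s = min da db / (2 * (norm v + norm w + 1))"
  have pos: "0 < 2 * (norm v + norm w + 1)"
    by (smt (verit) norm_ge_zero)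
  have s: "s > 0" unfolding s_def using pos da(1) db(1) by simp
  have s_eq: "s * (2 * (norm v + norm w + 1)) = min da db" unfolding s_def using pos by simp
  have close: "dist (x + r *\<^sub>R v + q *\<^sub>R w) x < min da db"
    if "0 \<le> r" "r \<le> s" "0 \<le> q" "q \<le> s" for r q
  proof -
    have "dist (x + r *\<^sub>R v + q *\<^sub>R w) x \<le> r * norm v + q * norm w"
      using norm_triangle_ineq[of "r *\<^sub>R v" "q *\<^sub>R w"] that by (simp add: dist_norm add.assoc)
    also have "\<dots> \<le> s * norm v + s * norm w"
      using that by (intro add_mono mult_right_mono) auto
    also have "\<dots> < s * (2 * (norm v + norm w + 1))"
      using s by (simp add: algebra_simps) (smt (verit) mult_nonneg_nonneg norm_ge_zero)
    finally show ?thesis using s_eq by simp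
  qed
  have close': "dist (x + r *\<^sub>R w + q *\<^sub>R v) x < min da db"
    if "0 \<le> r" "r \<le> s" "0 \<le> q" "q \<le> s" for r q
    using close[of q r] that by (simp add: algebra_simps)
  obtain r q where rq: "r \<in> {0..s}" "q \<in> {0..s}"
    "f (x + s *\<^sub>R v + s *\<^sub>R w) - f (x + s *\<^sub>R v) - f (x + s *\<^sub>R w) + f x
      = s * s * f'' v (x + r *\<^sub>R v + q *\<^sub>R w) w"
    using second_difference[OF s, of x v w S f f' "f'' v"] close da(2) f f' by force
  obtain r' q' where rq': "r' \<in> {0..s}" "q' \<in> {0..s}"
    "f (x + s *\<^sub>R w + s *\<^sub>R v) - f (x + s *\<^sub>R w) - f (x + s *\<^sub>R v) + f x
      = s * s * f'' w (x + r' *\<^sub>R w + q' *\<^sub>R v) v"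
    using second_difference[OF s, of x w v S f f' "f'' w"] close' da(2) f f' by force
  have "f'' v (x + r *\<^sub>R v + q *\<^sub>R w) w = f'' w (x + r' *\<^sub>R w + q' *\<^sub>R v) v"
  proof -
    have "s * s * f'' v (x + r *\<^sub>R v + q *\<^sub>R w) w = s * s * f'' w (x + r' *\<^sub>R w + q' *\<^sub>R v) v"
      unfolding rq(3)[symmetric] rq'(3)[symmetric] by (simp add: algebra_simps)
    then show ?thesis using s by simp
  qed
  moreover have "\<bar>f'' v (x + r *\<^sub>R v + q *\<^sub>R w) w - f'' v x w\<bar> < e"
    using da(2) close rq by simp
  moreover have "\<bar>f'' w (x + r' *\<^sub>R w + q' *\<^sub>R v) v - f'' w x v\<bar> < e"
    using db(2) close' rq' by simp
  ultimately show False unfolding e_def by (smt (verit) field_sum_of_halves)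
qed

lemma symmetric_second_derivative:
  fixes f :: "'a::real_normed_vector \<Rightarrow> 'b::euclidean_space"
  assumes "smooth_on f S" "open S" "x \<in> S"
  shows "frechet_derivative (\<lambda>y. frechet_derivative f (at y) v) (at x) w
       = frechet_derivative (\<lambda>y. frechet_derivative f (at y) w) (at x) v"
proof (rule euclidean_eqI)
  fix b :: 'b
  let ?D = "\<lambda>f y. frechet_derivative f (at y)"
  show "?D (\<lambda>y. ?D f y v) x w \<bullet> b = ?D (\<lambda>y. ?D f y w) x v \<bullet> b"
    by (rule symmetric_second_derivative_real[where f = "\<lambda>y. f y \<bullet> b" and f' = "\<lambda>y u. ?D f y u \<bullet> b"
          and f'' = "\<lambda>u y w. ?D (\<lambda>y. ?D f y u) y w \<bullet> b", OF assms(2,3)])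
       (auto intro!: has_derivative_inner_left smooth_on_has_derivative[OF _ assms(2)]
          continuous_on_inner continuous_on_const smooth_on_continuous[of "\<lambda>y. ?D _ y _"]
          smooth_on_derivative assms(1))
qed

text \<open>Sums and multiples are differentiated termwise and derivatives are unique, so linearity in the
  vector arguments passes from \<open>g y\<close> to the derivative \<open>D\<close>.\<close>

lemma multilinear_derivative:
  fixes D :: "'v::real_vector list \<Rightarrow> 'a::real_normed_vector \<Rightarrow> real"
  assumes ml: "\<And>y. multilinear k (g y)"
    and D: "\<And>ws. length ws = k \<Longrightarrow> ((\<lambda>y. g y ws) has_derivative D ws) (at x)"
  shows "multilinear k (\<lambda>ws. D ws v)"
  unfolding multilinear_def
proof (intro allI impI linearI)
  fix vs :: "'v list" and i :: nat and a b :: 'v and r :: real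
  assume vs: "length vs = k" "i < k"
  have lin: "linear (\<lambda>v. g y (vs[i := v]))" for y using ml vs unfolding multilinear_def by blast
  have "((\<lambda>y. g y (vs[i := a]) + g y (vs[i := b])) has_derivative
      (\<lambda>v. D (vs[i := a]) v + D (vs[i := b]) v)) (at x)"
    using vs by (intro has_derivative_add D) auto
  then have "((\<lambda>y. g y (vs[i := a + b])) has_derivative
      (\<lambda>v. D (vs[i := a]) v + D (vs[i := b]) v)) (at x)"
    using linear_add[OF lin] by simp
  from has_derivative_unique[OF this D[of "vs[i := a + b]"]]
  show "D (vs[i := a + b]) v = D (vs[i := a]) v + D (vs[i := b]) v" using vs by (simp add: fun_eq_iff)
  have "((\<lambda>y. r * g y (vs[i := a])) has_derivative (\<lambda>v. r * D (vs[i := a]) v)) (at x)"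
    using vs by (intro has_derivative_mult_right D) auto
  then have "((\<lambda>y. g y (vs[i := r *\<^sub>R a])) has_derivative (\<lambda>v. r * D (vs[i := a]) v)) (at x)"
    using linear_cmul[OF lin] by simp
  from has_derivative_unique[OF this D[of "vs[i := r *\<^sub>R a]"]]
  show "D (vs[i := r *\<^sub>R a]) v = r *\<^sub>R D (vs[i := a]) v" using vs by (simp add: fun_eq_iff)
qed

lemma linear_basis_expansion:
  fixes L :: "'v::euclidean_space \<Rightarrow> real"
  assumes "linear L"
  shows "L z = (\<Sum>b\<in>Basis. (z \<bullet> b) * L b)"
proof -
  have "L z = L (\<Sum>b\<in>Basis. (z \<bullet> b) *\<^sub>R b)" by (simp add: euclidean_representation)
  also have "\<dots> = (\<Sum>b\<in>Basis. (z \<bullet> b) * L b)"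
    using assms by (simp add: linear_sum linear_cmul)
  finally show ?thesis .
qed

text \<open>Product rule for a multilinear map that varies itself and is applied to moving vectors. The
  vectors are released one at a time: the last moving one is expanded in a basis, which reduces the
  claim to the ordinary product rule and to fewer moving vectors.\<close>

lemma has_derivative_multilinear:
  fixes g :: "'a::real_normed_vector \<Rightarrow> 'v::euclidean_space list \<Rightarrow> real"
  assumes ml: "\<And>y. multilinear k (g y)"
    and D: "\<And>ws. length ws = k \<Longrightarrow> ((\<lambda>y. g y ws) has_derivative D ws) (at x)"
    and u: "\<And>w. ((\<lambda>y. u y w) has_derivative u' w) (at x)"
    and "length ws + length cs = k"
  shows "((\<lambda>y. g y (map (u y) ws @ cs)) has_derivative
    (\<lambda>v. D (map (u x) ws @ cs) v
       + (\<Sum>m<length ws. g x ((map (u x) ws @ cs)[m := u' (ws ! m) v])))) (at x)"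
  using assms(4)
proof (induction ws arbitrary: cs rule: rev_induct)
  case Nil
  then show ?case using D by simp
next
  case (snoc w ws)
  have lin: "linear (\<lambda>z. g y (vs @ z # cs))" if "length vs = length ws" for y vs
    by (rule linear_arg[OF ml]) (use snoc.prems that in simp)
  have linD: "linear (\<lambda>z. D (map (u x) ws @ z # cs) v)" for v
    by (rule linear_arg[OF multilinear_derivative[OF ml D]]) (use snoc.prems in auto)
  have expand: "g y (map (u y) ws @ u y w # cs)
      = (\<Sum>b\<in>Basis. (u y w \<bullet> b) * g y (map (u y) ws @ b # cs))" for y
    by (rule linear_basis_expansion[OF lin]) simp
  let ?S = "\<lambda>v z. \<Sum>m<length ws. g x ((map (u x) ws @ z # cs)[m := u' (ws ! m) v])"
  have IH: "((\<lambda>y. g y (map (u y) ws @ b # cs)) has_derivative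
      (\<lambda>v. D (map (u x) ws @ b # cs) v + ?S v b)) (at x)" for b
    using snoc.IH[of "b # cs"] snoc.prems by simp
  have linS: "linear (?S v)" for v
    using lin by (intro linear_compose_sum) (simp add: list_update_append)
  have lin_sum: "linear (\<lambda>z. D (map (u x) ws @ z # cs) v + ?S v z)" for v
    by (intro linear_compose_add linD linS)
  have "((\<lambda>y. \<Sum>b\<in>Basis. (u y w \<bullet> b) * g y (map (u y) ws @ b # cs)) has_derivative
      (\<lambda>v. \<Sum>b\<in>Basis. (u x w \<bullet> b) * (D (map (u x) ws @ b # cs) v + ?S v b)
         + (u' w v \<bullet> b) * g x (map (u x) ws @ b # cs))) (at x)"
    by (intro has_derivative_sum has_derivative_mult has_derivative_inner_left u IH)
  also have "(\<lambda>v. \<Sum>b\<in>Basis. (u x w \<bullet> b) * (D (map (u x) ws @ b # cs) v + ?S v b)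
         + (u' w v \<bullet> b) * g x (map (u x) ws @ b # cs))
      = (\<lambda>v. D (map (u x) ws @ u x w # cs) v + ?S v (u x w) + g x (map (u x) ws @ u' w v # cs))"
    using linear_basis_expansion[OF lin_sum, where z = "u x w"]
      linear_basis_expansion[OF lin[of "map (u x) ws" x], where z = "u' w _"]
    by (simp add: sum.distrib fun_eq_iff)
  finally show ?case
    unfolding expand[symmetric] by (simp add: nth_append list_update_append add.assoc)
qed

section \<open>The exterior derivative of a form is a form\<close>

lemma open_target: "oriented_atlas A \<Longrightarrow> c \<in> A \<Longrightarrow> open (target c)"
  by (simp add: oriented_atlas_def is_chart_def)

lemma open_overlap:
  assumes "oriented_atlas A" "c \<in> A" "c' \<in> A"
  shows "open (overlap c c')"
proof -
  have ch: "is_chart c" "is_chart c'" using assms by (auto simp: oriented_atlas_def)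
  then have "openin (top_of_set (fst c)) (fst c \<inter> fst c')"
    by (auto simp: is_chart_def openin_open)
  then have "openin (top_of_set (target c)) (overlap c c')"
    unfolding overlap_def using ch(1) homeomorphism_imp_open_map unfolding is_chart_def by blast
  then show ?thesis using ch(1) openin_open_trans unfolding is_chart_def by blast
qed

lemma overlap_subset: "overlap c c' \<subseteq> target c"
  by (auto simp: overlap_def target_def)

lemma transition_in_target:
  assumes "oriented_atlas A" "c \<in> A" "x \<in> overlap c c'"
  shows "transition c c' x \<in> target c'"
proof -
  obtain q where q: "q \<in> fst c" "q \<in> fst c'" "x = snd c q"
    using assms(3) by (auto simp: overlap_def)
  have "homeomorphism (fst c) (target c) (snd c) (inv_into (fst c) (snd c))"
    using assms(1,2) by (simp add: oriented_atlas_def is_chart_def)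
  then have "inv_into (fst c) (snd c) x = q" using q by (simp add: homeomorphism_def)
  then show ?thesis using q by (simp add: transition_def target_def)
qed

lemma smooth_transition:
  "oriented_atlas A \<Longrightarrow> c \<in> A \<Longrightarrow> c' \<in> A \<Longrightarrow> smooth_on (transition c c') (overlap c c')"
  by (simp add: oriented_atlas_def)

lemma forms_zero:
  "\<omega> \<in> forms A k \<Longrightarrow> \<not> (c \<in> A \<and> x \<in> target c \<and> length vs = k) \<Longrightarrow> \<omega> c x vs = 0"
  unfolding forms_def tensor_fields_def by blast

lemma forms_multilinear:
  assumes "\<omega> \<in> forms A k"
  shows "multilinear k (\<omega> c x)"
proof (cases "c \<in> A \<and> x \<in> target c")
  case True
  then show ?thesis using assms unfolding forms_def tensor_fields_def multilinear_def by blast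
next
  case False
  then have "\<omega> c x vs = 0" for vs using forms_zero[OF assms] by blast
  then show ?thesis by (simp add: multilinear_def linear_zero)
qed

lemma forms_alternating:
  "\<omega> \<in> forms A k \<Longrightarrow> i < j \<Longrightarrow> j < length vs \<Longrightarrow> vs ! i = vs ! j \<Longrightarrow> \<omega> c x vs = 0"
  unfolding forms_def by blast

lemma forms_smooth: "\<omega> \<in> forms A k \<Longrightarrow> c \<in> A \<Longrightarrow> smooth_on (\<lambda>x. \<omega> c x vs) (target c)"
  unfolding forms_def tensor_fields_def by blast

lemma forms_transition:
  "\<omega> \<in> forms A k \<Longrightarrow> c \<in> A \<Longrightarrow> c' \<in> A \<Longrightarrow> x \<in> overlap c c' \<Longrightarrow>
    \<omega> c x vs = \<omega> c' (transition c c' x) (map (frechet_derivative (transition c c') (at x)) vs)"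
  unfolding forms_def tensor_fields_def by blast

lemma formsI:
  assumes "\<And>c x vs. \<not> (c \<in> A \<and> x \<in> target c \<and> length vs = k) \<Longrightarrow> \<omega> c x vs = 0"
    and "\<And>c x. c \<in> A \<Longrightarrow> x \<in> target c \<Longrightarrow> multilinear k (\<omega> c x)"
    and "\<And>c x vs i j. c \<in> A \<Longrightarrow> x \<in> target c \<Longrightarrow> length vs = k \<Longrightarrow> i < j \<Longrightarrow> j < k \<Longrightarrow>
      vs ! i = vs ! j \<Longrightarrow> \<omega> c x vs = 0"
    and "\<And>c vs. c \<in> A \<Longrightarrow> smooth_on (\<lambda>x. \<omega> c x vs) (target c)"
    and "\<And>c c' x vs. c \<in> A \<Longrightarrow> c' \<in> A \<Longrightarrow> x \<in> overlap c c' \<Longrightarrow> length vs = k \<Longrightarrow>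
      \<omega> c x vs = \<omega> c' (transition c c' x) (map (frechet_derivative (transition c c') (at x)) vs)"
  shows "\<omega> \<in> forms A k"
proof -
  have trans: "\<omega> c x vs = \<omega> c' (transition c c' x) (map (frechet_derivative (transition c c') (at x)) vs)"
    if "c \<in> A" "c' \<in> A" "x \<in> overlap c c'" for c c' x vs
    by (cases "length vs = k") (use assms(1,5) that in auto)
  have alt: "\<omega> c x vs = 0" if "i < j" "j < length vs" "vs ! i = vs ! j" for c x vs i j
    using assms(1,3) that by metis
  show ?thesis
    unfolding forms_def tensor_fields_def mem_Collect_eq
  proof (intro conjI)
    show "\<forall>c x vs. \<omega> c x vs \<noteq> 0 \<longrightarrow> c \<in> A \<and> x \<in> target c \<and> length vs = k"
      using assms(1) by blast
    show "\<forall>c\<in>A. \<forall>x\<in>target c. \<forall>vs. length vs = k \<longrightarrow> (\<forall>i<k. linear (\<lambda>v. \<omega> c x (vs[i := v])))"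
      using assms(2) unfolding multilinear_def by simp
    show "\<forall>c\<in>A. \<forall>c'\<in>A. \<forall>x\<in>overlap c c'. \<forall>vs. \<omega> c x vs
        = \<omega> c' (transition c c' x) (map (frechet_derivative (transition c c') (at x)) vs)"
      by (intro ballI allI trans)
    show "\<forall>c x vs i j. i < j \<and> j < length vs \<and> vs ! i = vs ! j \<longrightarrow> \<omega> c x vs = 0"
      using alt by blast
  qed (use assms(4) in simp)
qed

lemma forms_lincomb:
  assumes "oriented_atlas A" "\<omega> \<in> forms A k" "\<eta> \<in> forms A k"
  shows "a *\<^sub>f \<omega> + b *\<^sub>f \<eta> \<in> forms A k"
proof -
  have eq: "(a *\<^sub>f \<omega> + b *\<^sub>f \<eta>) c x vs = a * \<omega> c x vs + b * \<eta> c x vs" for c x vs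
    by (simp add: scale_form_def)
  show ?thesis
  proof (rule formsI, unfold eq, goal_cases)
    case (1 c x vs)
    then show ?case using assms(2,3)[THEN forms_zero] by simp
  next
    case (2 c x)
    show ?case
      unfolding multilinear_def eq
      using assms(2,3)[THEN forms_multilinear, of c x]
      by (auto simp: multilinear_def intro!: linear_compose_add linear_compose_scale_right[where 'b = real, simplified])
  next
    case (3 c x vs i j)
    then show ?case using assms(2,3)[THEN forms_alternating] by simp
  next
    case (4 c vs)
    then show ?case using assms by (intro smooth_on_lincomb forms_smooth open_target)
  next
    case (5 c c' x vs)
    then show ?case using assms(2,3)[THEN forms_transition, of c c' x vs] by simp
  qed
qed

lemma forms_add: "oriented_atlas A \<Longrightarrow> \<omega> \<in> forms A k \<Longrightarrow> \<eta> \<in> forms A k \<Longrightarrow> \<omega> + \<eta> \<in> forms A k"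
  using forms_lincomb[of A \<omega> k \<eta> 1 1] by simp

lemma forms_scale: "oriented_atlas A \<Longrightarrow> \<omega> \<in> forms A k \<Longrightarrow> a *\<^sub>f \<omega> \<in> forms A k"
  using forms_lincomb[of A \<omega> k \<omega> a 0] by (simp add: scale_form_def plus_fun_def)

lemma form_has_derivative:
  assumes "oriented_atlas A" "\<omega> \<in> forms A k" "c \<in> A" "x \<in> target c"
  shows "((\<lambda>y. \<omega> c y vs) has_derivative frechet_derivative (\<lambda>y. \<omega> c y vs) (at x)) (at x)"
  using smooth_on_has_derivative[OF forms_smooth] open_target assms by blast

lemma ext_deriv_eq:
  "c \<in> A \<Longrightarrow> x \<in> target c \<Longrightarrow> ext_deriv A \<omega> c x vs
    = (\<Sum>i<length vs. (-1) ^ i * frechet_derivative (\<lambda>y. \<omega> c y (omit i vs)) (at x) (vs ! i))"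
  by (simp add: ext_deriv_def omit_def)

text \<open>A slot \<open>j\<close> of the argument list is the direction of differentiation in the term \<open>i = j\<close> and an
  argument of the form in all other terms. Both dependences are linear.\<close>

lemma multilinear_ext_deriv:
  fixes A :: "('m::topological_space, 'n::finite) chart set"
  assumes "oriented_atlas A" "\<omega> \<in> forms A k" "c \<in> A" "x \<in> target c"
  shows "multilinear (Suc k) (ext_deriv A \<omega> c x)"
  unfolding multilinear_def
proof (intro allI impI)
  fix vs :: "(real ^ 'n) list" and j
  assume vs: "length vs = Suc k" "j < Suc k"
  let ?D = "\<lambda>ws. frechet_derivative (\<lambda>y. \<omega> c y ws) (at x)"
  have mlD: "multilinear k (\<lambda>ws. ?D ws w)" for w
    by (rule multilinear_derivative[where g = "\<omega> c", OF forms_multilinear[OF assms(2)]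
          form_has_derivative[OF assms]])
  have "linear (\<lambda>v. ?D (omit i (vs[j := v])) (vs[j := v] ! i))" if "i < Suc k" for i
  proof (cases "i = j")
    case True
    then show ?thesis
      using vs form_has_derivative[OF assms, THEN has_derivative_linear]
      by (simp add: omit_update_same)
  next
    case False
    define j' where "j' = (if j < i then j else j - 1)"
    have "j' < k" "length (omit i vs) = k" using vs that False by (auto simp: j'_def)
    then have "linear (\<lambda>v. ?D ((omit i vs)[j' := v]) (vs ! i))"
      using mlD unfolding multilinear_def by blast
    then show ?thesis using vs that False by (simp add: omit_update_other j'_def)
  qed
  then have "linear (\<lambda>v. \<Sum>i<Suc k. (-1) ^ i * ?D (omit i (vs[j := v])) (vs[j := v] ! i))"
    by (intro linear_compose_sum ballI linear_compose_scale_right[where 'b = real, simplified]) auto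
  then show "linear (\<lambda>v. ext_deriv A \<omega> c x (vs[j := v]))"
    using assms(3,4) vs by (simp add: ext_deriv_eq)
qed

text \<open>For two equal neighbours, omitting the one or the other gives the same list, and these two terms
  have opposite signs; all other terms contain the two equal vectors.\<close>

lemma alternating_ext_deriv:
  fixes A :: "('m::topological_space, 'n::finite) chart set"
  assumes "oriented_atlas A" "\<omega> \<in> forms A k" "c \<in> A" "x \<in> target c"
    and "length vs = Suc k" "i < j" "j < Suc k" "vs ! i = vs ! j"
  shows "ext_deriv A \<omega> c x vs = 0"
proof (rule alternating_if_adjacent[OF multilinear_ext_deriv[OF assms(1-4)] _ assms(5-8)])
  fix xs ys :: "(real ^ 'n) list" and a
  assume len: "length xs + Suc (Suc (length ys)) = Suc k"
  let ?vs = "xs @ a # a # ys" and ?j = "length xs"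
  have lvs: "length ?vs = Suc k" using len by simp
  let ?T = "\<lambda>i. (-1) ^ i * frechet_derivative (\<lambda>y. \<omega> c y (omit i ?vs)) (at x) (?vs ! i)"
  have zero: "?T i = 0" if "i < Suc k" "i \<noteq> ?j" "i \<noteq> Suc ?j" for i
  proof -
    define m where "m = (if i < ?j then ?j - 1 else ?j)"
    have m: "Suc m < length (omit i ?vs)" using that len by (auto simp: m_def)
    then have "omit i ?vs ! m = omit i ?vs ! Suc m"
      using that len by (auto simp: nth_omit m_def nth_append not_less_eq)
    then have "(\<lambda>y. \<omega> c y (omit i ?vs)) = (\<lambda>y. 0)"
      using forms_alternating[OF assms(2) lessI m] by blast
    then show ?thesis by simp
  qed
  have "ext_deriv A \<omega> c x ?vs = (\<Sum>i<Suc k. ?T i)"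
    unfolding ext_deriv_eq[OF assms(3,4)] lvs by (rule refl)
  also have "\<dots> = (\<Sum>i\<in>{?j, Suc ?j}. ?T i)"
    using zero len by (intro sum.mono_neutral_right) auto
  also have "\<dots> = 0"
    by (simp add: omit_def nth_append)
  finally show "ext_deriv A \<omega> c x ?vs = 0" .
qed

text \<open>Naturality. Differentiating the pullback by the product rule gives the pullback of the
  exterior derivative and terms with the second derivative of the coordinate change, which cancel
  because the second derivative is symmetric and \<open>\<omega>\<close> alternating.\<close>

lemma ext_deriv_transition:
  fixes A :: "('m::topological_space, 'n::finite) chart set"
  assumes at: "oriented_atlas A" and \<omega>: "\<omega> \<in> forms A k" and c: "c \<in> A" "c' \<in> A"
    and x: "x \<in> overlap c c'" and len: "length vs = Suc k"
  shows "ext_deriv A \<omega> c x vs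
    = ext_deriv A \<omega> c' (transition c c' x) (map (frechet_derivative (transition c c') (at x)) vs)"
proof -
  define \<tau> where "\<tau> = transition c c'"
  let ?L = "\<lambda>y. frechet_derivative \<tau> (at y)"
  let ?B = "\<lambda>w. frechet_derivative (\<lambda>y. ?L y w) (at x)"
  let ?D = "\<lambda>ws. frechet_derivative (\<lambda>z. \<omega> c' z ws) (at (\<tau> x))"
  have U: "open (overlap c c')" by (rule open_overlap[OF at c])
  have sm: "smooth_on \<tau> (overlap c c')" unfolding \<tau>_def by (rule smooth_transition[OF at c])
  have \<tau>x: "\<tau> x \<in> target c'" unfolding \<tau>_def by (rule transition_in_target[OF at c(1) x])
  have xt: "x \<in> target c" using x overlap_subset by blast
  have L: "(\<tau> has_derivative ?L x) (at x)" by (rule smooth_on_has_derivative[OF sm U x])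
  have L': "((\<lambda>y. ?L y w) has_derivative ?B w) (at x)" for w
    by (rule smooth_on_has_derivative[OF smooth_on_derivative[OF sm] U x])
  have symB: "?B w v = ?B v w" for v w by (rule symmetric_second_derivative[OF sm U x])
  have \<omega>D: "((\<lambda>y. \<omega> c' (\<tau> y) ws) has_derivative (\<lambda>v. ?D ws (?L x v))) (at x)" for ws
    by (rule has_derivative_compose[OF L form_has_derivative[OF at \<omega> c(2) \<tau>x]])
  have deriv: "frechet_derivative (\<lambda>y. \<omega> c y ws) (at x) v
      = ?D (map (?L x) ws) (?L x v) + (\<Sum>m<k. \<omega> c' (\<tau> x) ((map (?L x) ws)[m := ?B (ws ! m) v]))"
    if "length ws = k" for ws v
  proof -
    have "((\<lambda>y. \<omega> c' (\<tau> y) (map (?L y) ws @ [])) has_derivative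
      (\<lambda>v. ?D (map (?L x) ws @ []) (?L x v)
         + (\<Sum>m<length ws. \<omega> c' (\<tau> x) ((map (?L x) ws @ [])[m := ?B (ws ! m) v])))) (at x)"
      by (rule has_derivative_multilinear[of k "\<lambda>y. \<omega> c' (\<tau> y)" "\<lambda>ws v. ?D ws (?L x v)" x ?L ?B])
         (use forms_multilinear[OF \<omega>] \<omega>D L' that in auto)
    moreover have "\<omega> c' (\<tau> y) (map (?L y) ws @ []) = \<omega> c y ws" if "y \<in> overlap c c'" for y
      using forms_transition[OF \<omega> c that, of ws] by (simp add: \<tau>_def)
    ultimately have "((\<lambda>y. \<omega> c y ws) has_derivative
      (\<lambda>v. ?D (map (?L x) ws @ []) (?L x v)
         + (\<Sum>m<length ws. \<omega> c' (\<tau> x) ((map (?L x) ws @ [])[m := ?B (ws ! m) v])))) (at x)"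
      by (rule has_derivative_transform_within_open[OF _ U x])
    from fun_cong[OF frechet_derivative_at[OF this], of v] show ?thesis
      using that by simp
  qed
  let ?ws = "map (?L x) vs"
  have "ext_deriv A \<omega> c x vs
      = (\<Sum>i<Suc k. (-1) ^ i * frechet_derivative (\<lambda>y. \<omega> c y (omit i vs)) (at x) (vs ! i))"
    unfolding ext_deriv_eq[OF c(1) xt] len by (rule refl)
  also have "\<dots> = (\<Sum>i<Suc k. (-1) ^ i * ?D (omit i ?ws) (?ws ! i)
      + (-1) ^ i * (\<Sum>m<k. \<omega> c' (\<tau> x) ((omit i ?ws)[m := ?B (vs ! i) (vs ! (if m < i then m else Suc m))])))"
  proof (rule sum.cong)
    fix i assume "i \<in> {..<Suc k}"
    then have i: "i < length vs" "length (omit i vs) = k" using len by auto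
    have "(\<Sum>m<k. \<omega> c' (\<tau> x) ((omit i ?ws)[m := ?B (omit i vs ! m) (vs ! i)]))
        = (\<Sum>m<k. \<omega> c' (\<tau> x) ((omit i ?ws)[m := ?B (vs ! i) (vs ! (if m < i then m else Suc m))]))"
      using i len by (intro sum.cong refl) (simp add: nth_omit symB)
    then show "(-1) ^ i * frechet_derivative (\<lambda>y. \<omega> c y (omit i vs)) (at x) (vs ! i)
        = (-1) ^ i * ?D (omit i ?ws) (?ws ! i)
      + (-1) ^ i * (\<Sum>m<k. \<omega> c' (\<tau> x) ((omit i ?ws)[m := ?B (vs ! i) (vs ! (if m < i then m else Suc m))]))"
      using i by (simp add: deriv map_omit algebra_simps)
  qed simp
  also have "\<dots> = (\<Sum>i<Suc k. (-1) ^ i * ?D (omit i ?ws) (?ws ! i))"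
  proof -
    have "(\<Sum>i<Suc k. (-1) ^ i *
        (\<Sum>m<k. \<omega> c' (\<tau> x) ((omit i ?ws)[m := ?B (vs ! i) (vs ! (if m < i then m else Suc m))]))) = 0"
      by (rule symmetric_insertions_cancel[where B = "\<lambda>i j. ?B (vs ! i) (vs ! j)"])
         (use forms_multilinear[OF \<omega>] forms_alternating[OF \<omega>] symB len in auto)
    then show ?thesis unfolding sum.distrib by simp
  qed
  also have "\<dots> = ext_deriv A \<omega> c' (\<tau> x) ?ws"
    unfolding ext_deriv_eq[OF c(2) \<tau>x] by (simp add: len)
  finally show ?thesis by (simp add: \<tau>_def)
qed

lemma ext_deriv_in_forms:
  fixes A :: "('m::topological_space, 'n::finite) chart set"
  assumes at: "oriented_atlas A" and \<omega>: "\<omega> \<in> forms A k"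
  shows "ext_deriv A \<omega> \<in> forms A (Suc k)"
proof (rule formsI)
  fix c x and vs :: "(real ^ 'n) list"
  assume *: "\<not> (c \<in> A \<and> x \<in> target c \<and> length vs = Suc k)"
  show "ext_deriv A \<omega> c x vs = 0"
  proof (cases "c \<in> A \<and> x \<in> target c")
    case True
    have "(\<lambda>y. \<omega> c y (omit i vs)) = (\<lambda>y. 0)" if "i < length vs" for i
      using forms_zero[OF \<omega>, of c _ "omit i vs"] that True * by fastforce
    then show ?thesis using True by (simp add: ext_deriv_eq)
  qed (auto simp: ext_deriv_def)
next
  fix c and vs :: "(real ^ 'n) list"
  assume c: "c \<in> A"
  show "smooth_on (\<lambda>x. ext_deriv A \<omega> c x vs) (target c)"
    by (rule smooth_on_cong[OF open_target[OF at c] ext_deriv_eq[OF c, symmetric] smooth_on_sum_scaled])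
       (auto intro: open_target[OF at c] smooth_on_derivative forms_smooth[OF \<omega> c])
qed (use multilinear_ext_deriv[OF at \<omega>] alternating_ext_deriv[OF at \<omega>] ext_deriv_transition[OF at \<omega>] in blast)+

lemma ext_deriv_lincomb:
  fixes A :: "('m::topological_space, 'n::finite) chart set"
  assumes "oriented_atlas A" "\<omega> \<in> forms A k" "\<eta> \<in> forms A k"
  shows "ext_deriv A (a *\<^sub>f \<omega> + b *\<^sub>f \<eta>) = a *\<^sub>f ext_deriv A \<omega> + b *\<^sub>f ext_deriv A \<eta>"
proof (intro ext)
  fix c :: "('m, 'n) chart" and x :: "real ^ 'n" and vs :: "(real ^ 'n) list"
  let ?D = "\<lambda>\<omega> ws. frechet_derivative (\<lambda>y. \<omega> c y ws) (at x)"
  show "ext_deriv A (a *\<^sub>f \<omega> + b *\<^sub>f \<eta>) c x vs = (a *\<^sub>f ext_deriv A \<omega> + b *\<^sub>f ext_deriv A \<eta>) c x vs"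
  proof (cases "c \<in> A \<and> x \<in> target c")
    case True
    have "?D (a *\<^sub>f \<omega> + b *\<^sub>f \<eta>) ws = (\<lambda>v. a * ?D \<omega> ws v + b * ?D \<eta> ws v)" for ws
      unfolding scale_form_def plus_fun_def
      by (rule sym, rule frechet_derivative_at, intro derivative_intros)
         (use True assms form_has_derivative in blast)+
    then show ?thesis
      using True by (simp add: ext_deriv_eq scale_form_def plus_fun_def sum_distrib_left
          algebra_simps flip: sum.distrib)
  qed (auto simp: ext_deriv_def scale_form_def)
qed

section \<open>The critical Branson--Gover operator\<close>

lemma scale_form_zero [simp]: "0 *\<^sub>f \<omega> = 0" "a *\<^sub>f (0 :: ('m, 'n) tensor) = 0"
  by (simp_all add: scale_form_def fun_eq_iff)

lemma scale_form_add_left: "(a + b) *\<^sub>f \<omega> = a *\<^sub>f \<omega> + b *\<^sub>f \<omega>"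
  by (simp add: scale_form_def fun_eq_iff algebra_simps)

lemma add_const_add_const: "add_const (add_const D a) b = add_const D (a + b)"
  by (simp add: add_const_def scale_form_add_left fun_eq_iff add.assoc)

lemma op_prod_cong: "(\<And>l. 1 \<le> l \<Longrightarrow> l \<le> k \<Longrightarrow> F l = G l) \<Longrightarrow> op_prod F k = op_prod G k"
  by (induction k) auto

lemma delta_d_in_forms:
  assumes "oriented_atlas A" "codifferential A h \<delta>" "\<omega> \<in> forms A k"
  shows "\<delta> (ext_deriv A \<omega>) \<in> forms A k"
  using assms(2) ext_deriv_in_forms[OF assms(1,3)] unfolding codifferential_def by blast

lemma delta_d_lincomb:
  assumes "oriented_atlas A" "codifferential A h \<delta>" "\<omega> \<in> forms A k" "\<eta> \<in> forms A k"
  shows "\<delta> (ext_deriv A (a *\<^sub>f \<omega> + b *\<^sub>f \<eta>)) = a *\<^sub>f \<delta> (ext_deriv A \<omega>) + b *\<^sub>f \<delta> (ext_deriv A \<eta>)"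
proof -
  note d = ext_deriv_in_forms[OF assms(1,3)] ext_deriv_in_forms[OF assms(1,4)]
  have add: "\<delta> (\<beta> + \<gamma>) = \<delta> \<beta> + \<delta> \<gamma>" if "\<beta> \<in> forms A (Suc k)" "\<gamma> \<in> forms A (Suc k)" for \<beta> \<gamma>
    using assms(2) that unfolding codifferential_def by blast
  have scale: "\<delta> (a *\<^sub>f \<beta>) = a *\<^sub>f \<delta> \<beta>" if "\<beta> \<in> forms A (Suc k)" for a \<beta>
    using assms(2) that unfolding codifferential_def by blast
  show ?thesis
    by (simp add: ext_deriv_lincomb[OF assms(1,3,4)] add scale forms_scale assms(1) d)
qed

text \<open>The factors \<open>D + c\<^sub>l\<close> are polynomials in \<open>D\<close>, so they commute with \<open>D\<close>.\<close>

lemma op_prod_add_const_commute: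
  assumes closed: "\<And>\<omega>. \<omega> \<in> V \<Longrightarrow> D \<omega> \<in> V" "\<And>a \<omega>. \<omega> \<in> V \<Longrightarrow> a *\<^sub>f \<omega> \<in> V"
      "\<And>\<omega> \<eta>. \<omega> \<in> V \<Longrightarrow> \<eta> \<in> V \<Longrightarrow> \<omega> + \<eta> \<in> V"
    and lin: "\<And>a b \<omega> \<eta>. \<omega> \<in> V \<Longrightarrow> \<eta> \<in> V \<Longrightarrow> D (a *\<^sub>f \<omega> + b *\<^sub>f \<eta>) = a *\<^sub>f D \<omega> + b *\<^sub>f D \<eta>"
    and "\<omega> \<in> V"
  shows "op_prod (\<lambda>l. add_const D (c l)) k \<omega> \<in> V
    \<and> op_prod (\<lambda>l. add_const D (c l)) k (D \<omega>) = D (op_prod (\<lambda>l. add_const D (c l)) k \<omega>)"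
  using \<open>\<omega> \<in> V\<close>
proof (induction k arbitrary: \<omega>)
  case (Suc k)
  have mem: "add_const D a \<omega> \<in> V" for a
    using Suc.prems closed by (simp add: add_const_def)
  have "D (D \<omega> + a *\<^sub>f \<omega>) = D (D \<omega>) + a *\<^sub>f D \<omega>" for a
    using lin[OF closed(1)[OF Suc.prems] Suc.prems, of 1 a] by simp
  then have "add_const D a (D \<omega>) = D (add_const D a \<omega>)" for a
    by (simp add: add_const_def)
  then show ?case using Suc.IH[OF mem] by simp
qed simp

text \<open>In the critical case \<open>N = \<beta>/2\<close>, the second summand has the coefficient \<open>\<beta>/2 - N = 0\<close>. For
  \<open>J \<noteq> 0\<close>, the powers of \<open>2 J / n\<close> are distributed over the factors of the first one.\<close>

lemma branson_gover_critical:
  fixes A :: "('m::topological_space, 'n::finite) chart set"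
  assumes at: "oriented_atlas A" and \<delta>: "codifferential A h \<delta>" and \<omega>: "\<omega> \<in> forms A p"
    and N: "real CARD('n) - 2 * real p = 2 * real N"
  shows "branson_gover A \<delta> J p N \<omega> = (2 * real N) *\<^sub>f
    R_cleared (2 * J / real CARD('n)) N 0
      (add_const (\<lambda>\<omega>. \<delta> (ext_deriv A \<omega>)) (2 * J / real CARD('n) * (real N * (real N - 1)))) \<omega>"
proof -
  define n where "n = real CARD('n)"
  define t where "t = 2 * J / n"
  define D where "D = (\<lambda>\<omega>. \<delta> (ext_deriv A \<omega>))"
  have n: "n > 0" by (simp add: n_def)
  have \<beta>: "n - 2 * real p = 2 * real N" using N by (simp add: n_def)
  let ?b = "real N * (real N - 1)"
  show ?thesis
  proof (cases "J = 0")
    case True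
    then show ?thesis using N by (simp add: branson_gover_def Let_def)
  next
    case False
    let ?y = "add_const (\<lambda>\<omega>. (n / (2 * J)) *\<^sub>f D \<omega>) ?b"
    have t: "t * (n / (2 * J)) = 1" using False n by (simp add: t_def)
    have Y: "(\<lambda>\<eta>. t *\<^sub>f ?y \<eta>) = add_const D (t * ?b)"
      by (simp only: add_const_def scale_form_simps t)
    have closed: "D \<eta> \<in> forms A p" if "\<eta> \<in> forms A p" for \<eta>
      unfolding D_def by (rule delta_d_in_forms[OF at \<delta> that])
    have Dscale: "D (a *\<^sub>f \<eta>) = a *\<^sub>f D \<eta>" if "\<eta> \<in> forms A p" for a \<eta>
      using delta_d_lincomb[OF at \<delta> that that, of a 0] by (simp add: D_def)
    have "branson_gover A \<delta> J p N \<omega> = (t ^ N) *\<^sub>f (2 * real N) *\<^sub>f R_op N 0 ?y \<omega>"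
      using False N by (simp add: branson_gover_def Let_def n_def t_def D_def)
    also have "\<dots> = (2 * real N) *\<^sub>f (t ^ N) *\<^sub>f R_op N 0 ?y \<omega>"
      by (simp add: mult.commute)
    also have "(t ^ N) *\<^sub>f R_op N 0 ?y \<omega> = R_cleared t N 0 (\<lambda>\<eta>. t *\<^sub>f ?y \<eta>) \<omega>"
      by (rule R_cleared_eq[OF \<omega>, symmetric])
         (auto simp: add_const_def Dscale mult.commute intro!: forms_add forms_scale at closed)
    finally show ?thesis unfolding Y by (simp add: t_def n_def D_def)
  qed
qed

theorem theorem4p6:
  fixes A :: "('m::{t2_space, second_countable_topology}, 'n::finite) chart set"
    and h :: "('m, 'n) tensor"
    and \<delta> :: "('m, 'n) tensor \<Rightarrow> ('m, 'n) tensor"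
    and J \<beta> :: real and n p :: nat
  assumes "n = CARD('n)" and "n \<ge> 3" and "even n" and "2 * p < n"
    and "\<beta> = real n - 2 * real p"
    and "oriented_atlas A" and "riemannian_metric A h" and "einstein A h J"
    and "codifferential A h \<delta>"
  shows "\<forall>\<omega>\<in>forms A p.
    branson_gover A \<delta> J p ((n - 2 * p) div 2) \<omega> \<in> forms A p \<and>
    branson_gover A \<delta> J p ((n - 2 * p) div 2) \<omega> =
      real (n - 2 * p) *\<^sub>f
        ((\<lambda>\<eta>. \<delta> (ext_deriv A \<eta>)) \<circ>
         op_prod (\<lambda>l. add_const (\<lambda>\<eta>. \<delta> (ext_deriv A \<eta>))
             ((\<beta>/2 - real l) * (\<beta>/2 + real l - 1) * (2 * J / real n)))
           ((n - 2 * p) div 2 - 1)) \<omega>"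
proof
  fix \<omega> assume \<omega>: "\<omega> \<in> forms A p"
  define N where "N = (n - 2 * p) div 2"
  define t where "t = 2 * J / real n"
  define D where "D = (\<lambda>\<eta>. \<delta> (ext_deriv A \<eta>))"
  let ?c = "\<lambda>l. (\<beta>/2 - real l) * (\<beta>/2 + real l - 1) * t"
  let ?P = "op_prod (\<lambda>l. add_const D (?c l))"
  have "even (n - 2 * p)" using assms(3,4) by simp
  then have N2: "n - 2 * p = 2 * N" by (simp add: N_def)
  obtain M where M: "N = Suc M" using N2 assms(4) by (cases N) auto
  have "real n - 2 * real p = real (n - 2 * p)" using assms(4) by simp
  then have N: "real CARD('n) - 2 * real p = 2 * real N" and \<beta>: "\<beta> = 2 * real N"
    using N2 assms(1,5) by simp_all
  have lin: "D (a *\<^sub>f \<zeta> + b *\<^sub>f \<eta>) = a *\<^sub>f D \<zeta> + b *\<^sub>f D \<eta>"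
    if "\<zeta> \<in> forms A p" "\<eta> \<in> forms A p" for a b \<zeta> \<eta>
    unfolding D_def by (rule delta_d_lincomb[OF assms(6,9) that])
  have closed: "D \<eta> \<in> forms A p" if "\<eta> \<in> forms A p" for \<eta>
    unfolding D_def by (rule delta_d_in_forms[OF assms(6,9) that])
  have P: "?P k \<omega> \<in> forms A p" "?P k (D \<omega>) = D (?P k \<omega>)" for k
    using op_prod_add_const_commute[where V = "forms A p" and D = D, OF closed
        forms_scale[OF assms(6)] forms_add[OF assms(6)] lin \<omega>] by auto
  \<comment> \<open>The innermost factor has \<open>l = N = \<beta>/2\<close>, so its constant vanishes.\<close>
  have last: "add_const D (?c N) \<omega> = D \<omega>"
    by (simp add: \<beta> add_const_def)
  have "R_cleared t N 0 (add_const D (t * (real N * (real N - 1)))) = ?P N"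
    unfolding R_cleared_def add_const_add_const \<beta>
    by (intro op_prod_cong arg_cong[where f = "add_const D"]) (simp add: algebra_simps)
  then have R: "R_cleared t N 0 (add_const D (t * (real N * (real N - 1)))) \<omega> = D (?P M \<omega>)"
    by (simp only: M op_prod.simps comp_apply last[unfolded M] P(2))
  have eq: "branson_gover A \<delta> J p N \<omega> = real (n - 2 * p) *\<^sub>f D (?P M \<omega>)"
    unfolding branson_gover_critical[OF assms(6,9) \<omega> N] using R N2
    by (simp add: t_def D_def assms(1))
  moreover have "real (n - 2 * p) *\<^sub>f D (?P M \<omega>) \<in> forms A p"
    by (intro forms_scale assms(6) closed P)
  ultimately show "branson_gover A \<delta> J p ((n - 2 * p) div 2) \<omega> \<in> forms A p \<and>
    branson_gover A \<delta> J p ((n - 2 * p) div 2) \<omega> =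
      real (n - 2 * p) *\<^sub>f
        ((\<lambda>\<eta>. \<delta> (ext_deriv A \<eta>)) \<circ>
         op_prod (\<lambda>l. add_const (\<lambda>\<eta>. \<delta> (ext_deriv A \<eta>))
             ((\<beta>/2 - real l) * (\<beta>/2 + real l - 1) * (2 * J / real n)))
           ((n - 2 * p) div 2 - 1)) \<omega>"
    using M by (simp add: D_def t_def flip: N_def)
qed

end
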